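(* Consider an iteration $k\in\mathbb N$ of the method B-STEP-DCA described in the context, with current iterate $(x_k,u_k)\in X_0$ and subgradient collection $V_k$, and let $\varepsilon_k\ge 0$. For each value $c\ge c_0$ of the penalty parameter let $(x_k[c],u_k[c])\in X_0$ be an $\varepsilon_k$-optimal solution of $\min_{(x,u)\in X_0}Q_{c,k}(x,u)$ satisfying $Q_{c,k}(x_k[c],u_k[c])\le Q_{c,k}(x_k,u_k)$, and let $(\widehat x_k,\widehat u_k)$ be an $\varepsilon_k$-optimal solution of $\min_{(x,u)\in X_0}\Gamma_k(x,u)$ (if $\varepsilon_k=0$ these solutions are assumed to exist). Then: 1. If $\Gamma_k(\widehat x_k,\widehat u_k)\ge\Gamma_k(x_k,u_k)$, then for any $\varepsilon_{feas}>0$ there exists $c_*>0$ such that for all values $c_+\ge c_*$ of the penalty parameter $$\Gamma_k(x_k[c_+],u_k[c_+])\le\Gamma_k(x_k,u_k)+\varepsilon_{feas}.$$ 2. If $\Gamma_k(\widehat x_k,\widehat u_k)<\Gamma_k(x_k,u_k)$, then for any $\eta_1\in(0,1)$ there exists $c_*>0$ such that for all values $c_+\ge c_*$ of the penalty parameter $$\Gamma_k(x_k[c_+],u_k[c_+])-\Gamma_k(x_k,u_k)\le\eta_1\big(\Gamma_k(\widehat x_k,\widehat u_k)-\Gamma_k(x_k,u_k)\big).$$ 3. For any $\eta_2\in(0,1)$ there exists $c_*\ge c_+$ (where $c_+$ is the value with which Step 4 is entered) such that for all $c_{k+1}\ge c_*$ $$Q_{c_{k+1},k}(x_k[c_{k+1}],u_k[c_{k+1}])-Q_{c_{k+1},k}(x_k,u_k)\le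 c_{k+1}\eta_2\big(\Gamma_k(x_k[c_{k+1}],u_k[c_{k+1}])-\Gamma_k(x_k,u_k)\big).$$
   Context: Notation. $T>0$; $|\cdot|$ is the Euclidean norm; $\mathbb N=\{0,1,2,\dots\}$; $\|\cdot\|_s$ is the $L^s$ norm on $[0,T]$, and $\|(x,u)\|_2^2=\int_0^T(|x(t)|^2+|u(t)|^2)\,dt$; $W^{1,s}([0,T];\mathbb R^n)$ is the space of absolutely continuous $x$ with $\dot x\in L^s$, normed by $\|x\|_{1,s}=\|x\|_s+\|\dot x\|_s$. $X=W^{1,\infty}([0,T];\mathbb R^n)\times L^\infty([0,T];\mathbb R^m)$ with norm $\|x\|_{1,\infty}+\|u\|_\infty$; $Y=W^{1,1}([0,T];\mathbb R^n)\times L^1([0,T];\mathbb R^m)$ with norm $\|x\|_{1,1}+\|u\|_1$. $X_0\subseteq X$ is a convex set closed in $X$ with respect to the topology of $Y$. $\partial$ is the convex subdifferential, $\partial_{x,u}$ the one with respect to $(x,u)$. A point $z\in X_0$ is $\varepsilon$-optimal for minimising $f$ over $X_0$ if $f(z)\le\inf_{X_0}f+\varepsilon$. Problem $(\mathcal P)$: minimise $J(x,u)=\int_0^TF_0(x(t),u(t),t)\,dt+f_0(x(0),x(T))$ over $(x,u)\in X_0$ subject to $\dot x(t)=F(x(t),u(t),t)$ for a.e. $t$; $f_i(x(0),x(T))\le0$, $i\in\mathcal I=\{1,\dots,\ell_I\}$; $f_j(x(0),x(T))=0$, $j\in\mathcal E=\{\ell_I+1,\dots,\ell_E\}$; $\Xi_s(x(t),u(t),t)\le0$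 for a.e. $t$, $s\in\mathcal M=\{1,\dots,\ell_M\}$ (index sets may be empty). Here $F_0=G_0-H_0$, $F=G-H$ ($\mathbb R^n$-valued, components $F_i=G_i-H_i$, $i=1,\dots,n$), $f_i=g_i-h_i$ on $\mathbb R^{2n}$, $\Xi_s=p_s-q_s$, where $G_i,H_i$ ($0\le i\le n$), $p_s,q_s$ are real-valued functions of $(x,u,t)\in\mathbb R^n\times\mathbb R^m\times[0,T]$ convex in $(x,u)$, and $g_i,h_i$ are real-valued convex functions (possibly nonsmooth). Data assumptions. $G_i,H_i$ ($0\le i\le n$), $p_s,q_s$ are Carathéodory (continuous in $(x,u)$ for a.e. $t$, measurable in $t$); for every $(x,u)\in X$ the multifunctions $t\mapsto\partial_{x,u}G_i(x(t),u(t),t)$, and likewise for $H_i,p_s,q_s$, are measurable; for every $R>0$ there is $\gamma_R>0$ such that for a.e. $t$ and all $(x,u)$ with $|x|+|u|\le R$ the absolute values of all these functions at $(x,u,t)$, and the norms of all their subgradients in $(x,u)$ there, are at most $\gamma_R$. Penalty function. $\Phi_c=J+c\varphi$, $\varphi(x,u)=\sum_{i=1}^n\int_0^T|\dot x_i(t)-F_i(x(t),u(t),t)|\,dt+\sum_{i\in\mathcal I}\max\{0,f_i(x(0),x(T))\}+\sum_{j\in\mathcal E}|f_j(x(0),x(T))|+\sum_{s\in\mathcal M}\int_0^T\max\{0,\Xi_s(x(t),u(t),t)\}\,dt$. Convex majorants. A collection of subgradients at $(\bar x,\bar u)\in X$ is $V=(V_0,\dots,V_n,W_1,\dots,W_n,v_0,\dots,v_{\ell_E},w_{\ell_I+1},\dots,w_{\ell_E},z_1,\dots,z_{\ell_M})$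 with $V_i,W_i,z_s$ measurable on $[0,T]$ and, for a.e. $t$, $V_i(t)\in\partial_{x,u}H_i(\bar x(t),\bar u(t),t)$, $W_i(t)\in\partial_{x,u}G_i(\bar x(t),\bar u(t),t)$, $z_s(t)\in\partial_{x,u}q_s(\bar x(t),\bar u(t),t)$, $v_i\in\partial h_i(\bar x(0),\bar x(T))$, $w_j\in\partial g_j(\bar x(0),\bar x(T))$. With $\Delta(t)=(x(t)-\bar x(t),u(t)-\bar u(t))$, $\Delta_b=(x(0)-\bar x(0),x(T)-\bar x(T))$, put $\Gamma(x,u;\bar x,\bar u;V)=\sum_{i=1}^n\int_0^T\max\{\dot x_i+H_i(x,u,t)-G_i(\bar x,\bar u,t)-\langle W_i,\Delta\rangle,\,-\dot x_i+G_i(x,u,t)-H_i(\bar x,\bar u,t)-\langle V_i,\Delta\rangle\}\,dt+\sum_{i\in\mathcal I}\max\{0,g_i(x(0),x(T))-h_i(\bar x(0),\bar x(T))-\langle v_i,\Delta_b\rangle\}+\sum_{j\in\mathcal E}\max\{g_j(x(0),x(T))-h_j(\bar x(0),\bar x(T))-\langle v_j,\Delta_b\rangle,\,h_j(x(0),x(T))-g_j(\bar x(0),\bar x(T))-\langle w_j,\Delta_b\rangle\}+\sum_{s\in\mathcal M}\int_0^T\max\{0,p_s(x,u,t)-q_s(\bar x,\bar u,t)-\langle z_s,\Delta\rangle\}\,dt$ (functions under integrals evaluated at $t$), $\omega(x,u;V)=\int_0^T(G_0(x(t),u(t),t)-\langle V_0(t),(x(t),u(t))\rangle)\,dt+g_0(x(0),x(T))-\langle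 v_0,(x(0),x(T))\rangle$, and $Q_c(x,u;\bar x,\bar u;V)=\omega(x,u;V)+c\,\Gamma(x,u;\bar x,\bar u;V)$. Method B-STEP-DCA. Choose $(x_0,u_0)\in X_0$, $c_0>0$, $\eta_1,\eta_2,\zeta,\sigma\in(0,1)$, $\varepsilon_\varphi,\varepsilon_{feas}>0$, $\{\varepsilon_k\}\subset(0,\infty)$. For iteration $k=0,1,\dots$: pick a collection of subgradients $V_k$ at $(x_k,u_k)$; write $\Gamma_k(\cdot)=\Gamma(\cdot;x_k,u_k;V_k)$, $\omega_k(\cdot)=\omega(\cdot;V_k)$, $Q_{c,k}=\omega_k+c\Gamma_k$; $(x_k[c],u_k[c])$ denotes a computed $\varepsilon_k$-optimal solution of $\min_{X_0}Q_{c,k}$. Step 1: $c_+=c_k$; compute $(x_k[c_+],u_k[c_+])$; if $\Gamma_k(x_k[c_+],u_k[c_+])\le\varepsilon_\varphi$ go to Step 4, else to Step 2. Step 2: compute an $\varepsilon_k$-optimal solution $(\widehat x_k,\widehat u_k)$ of $\min_{X_0}\Gamma_k$. If $\Gamma_k(\widehat x_k,\widehat u_k)<\Gamma_k(x_k,u_k)$ go to Step 3. Otherwise, while $\Gamma_k(x_k[c_+],u_k[c_+])\le\Gamma_k(x_k,u_k)+\varepsilon_{feas}$ fails, increase $c_+$ and recompute $(x_k[c_+],u_k[c_+])$; then go to Step 4. Step 3: while $\Gamma_k(x_k[c_+],u_k[c_+])-\Gamma_k(x_k,u_k)\le\eta_1(\Gamma_k(\widehat x_k,\widehat u_k)-\Gamma_k(x_k,u_k))$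 fails, increase $c_+$ and recompute; then go to Step 4. Step 4: put $c_{k+1}=c_+$; while $Q_{c_{k+1},k}(x_k[c_{k+1}],u_k[c_{k+1}])-Q_{c_{k+1},k}(x_k,u_k)\le c_{k+1}\eta_2(\Gamma_k(x_k[c_{k+1}],u_k[c_{k+1}])-\Gamma_k(x_k,u_k))$ fails, increase $c_{k+1}$ and recompute. Step 5: with $d_k=(x_k[c_{k+1}]-x_k,u_k[c_{k+1}]-u_k)$, choose $\nu_k>0$, $\overline\alpha_k\ge0$, find the smallest $j_k\in\mathbb N$ such that, for $\alpha_k=\zeta^{j_k}\overline\alpha_k$, $\Phi_{c_{k+1}}((x_k[c_{k+1}],u_k[c_{k+1}])+\alpha_kd_k)-\Phi_{c_{k+1}}(x_k[c_{k+1}],u_k[c_{k+1}])\le-\sigma\alpha_k^2\|d_k\|_2^2+\nu_k$; set $(x_{k+1},u_{k+1})=(x_k[c_{k+1}],u_k[c_{k+1}])+\alpha_kd_k$. Standing assumptions on the method. All computed points $(x_k[c],u_k[c])$ satisfy $Q_{c,k}(x_k[c],u_k[c])\le Q_{c,k}(x_k,u_k)$. The trial step $\overline\alpha_k$ is such that $(x_k[c_{k+1}],u_k[c_{k+1}])+\zeta^j\overline\alpha_kd_k\in X_0$ for all $j\in\mathbb N$. $\Phi_{c_0}$ is bounded below on $X_0$. All penalty parameter values used are at least $c_0$. *)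

theory Defs
  imports "HOL-Analysis.Analysis"
begin

section \<open>Function spaces on \<open>[0, T]\<close>\<close>

text \<open>
  Trajectories are honest functions on the real line; only their restriction to \<open>[0, T]\<close> matters.
  Almost everywhere equal controls are not identified, but a set that is closed in the sense of
  \<open>closed_in_X\<close> below automatically contains, with a pair \<open>(x, u)\<close>, every element of \<open>X\<close> that agrees
  with it on \<open>[0, T]\<close> up to a null set.
\<close>

type_synonym ('n, 'm) traj = "(real \<Rightarrow> real ^ 'n) \<times> (real \<Rightarrow> real ^ 'm)"

abbreviation leb :: "real \<Rightarrow> real measure" where
  "leb T \<equiv> lebesgue_on {0..T}"

definition abs_continuous :: "real \<Rightarrow> (real \<Rightarrow> 'a::real_normed_vector) \<Rightarrow> bool" where
  "abs_continuous T x \<longleftrightarrow>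
     (\<forall>e>0. \<exists>d>0. \<forall>(N::nat) a b.
        (\<forall>i<N. 0 \<le> a i \<and> a i \<le> b i \<and> b i \<le> T) \<and>
        disjoint_family_on (\<lambda>i. {a i<..<b i}) {..<N} \<and>
        (\<Sum>i<N. b i - a i) < d
        \<longrightarrow> (\<Sum>i<N. norm (x (b i) - x (a i))) < e)"

definition xdot :: "real \<Rightarrow> (real \<Rightarrow> 'a::real_normed_vector) \<Rightarrow> real \<Rightarrow> 'a" where
  "xdot T x t = vector_derivative x (at t within {0..T})"

definition in_Linf :: "real \<Rightarrow> (real \<Rightarrow> 'a::euclidean_space) \<Rightarrow> bool" where
  "in_Linf T f \<longleftrightarrow> f \<in> borel_measurable (leb T) \<and> (\<exists>B. AE t in leb T. norm (f t) \<le> B)"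

definition space_X :: "real \<Rightarrow> ('n::finite, 'm::finite) traj set" where
  "space_X T = {(x, u). abs_continuous T x \<and> in_Linf T (xdot T x) \<and> in_Linf T u}"

definition norm_Y :: "real \<Rightarrow> ('n::finite, 'm::finite) traj \<Rightarrow> real" where
  "norm_Y T z = (LINT t|leb T. norm (fst z t)) + (LINT t|leb T. norm (xdot T (fst z) t))
     + (LINT t|leb T. norm (snd z t))"

definition traj_comb ::
    "real \<Rightarrow> ('n::finite, 'm::finite) traj \<Rightarrow> real \<Rightarrow> ('n, 'm) traj \<Rightarrow> ('n, 'm) traj" where
  "traj_comb a z b w = ((\<lambda>t. a *\<^sub>R fst z t + b *\<^sub>R fst w t), (\<lambda>t. a *\<^sub>R snd z t + b *\<^sub>R snd w t))"

definition convex_trajs :: "('n::finite, 'm::finite) traj set \<Rightarrow> bool" where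
  "convex_trajs S \<longleftrightarrow>
     (\<forall>z\<in>S. \<forall>w\<in>S. \<forall>a\<ge>0. \<forall>b\<ge>0. a + b = 1 \<longrightarrow> traj_comb a z b w \<in> S)"

definition closed_in_X :: "real \<Rightarrow> ('n::finite, 'm::finite) traj set \<Rightarrow> bool" where
  "closed_in_X T S \<longleftrightarrow>
     (\<forall>z\<in>space_X T. (\<forall>r>0. \<exists>w\<in>S. norm_Y T (traj_comb 1 w (- 1) z) < r) \<longrightarrow> z \<in> S)"

definition at_time :: "('n::finite, 'm::finite) traj \<Rightarrow> real \<Rightarrow> (real ^ 'n) \<times> (real ^ 'm)" where
  "at_time z t = (fst z t, snd z t)"

definition ends :: "real \<Rightarrow> ('n::finite, 'm::finite) traj \<Rightarrow> (real ^ 'n) \<times> (real ^ 'n)" where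
  "ends T z = (fst z 0, fst z T)"


section \<open>Subdifferentials and measurable multifunctions\<close>

definition subdiff :: "('a::real_inner \<Rightarrow> real) \<Rightarrow> 'a \<Rightarrow> 'a set" where
  "subdiff f z = {v. \<forall>w. f z + v \<bullet> (w - z) \<le> f w}"

definition measurable_multifun :: "real \<Rightarrow> (real \<Rightarrow> 'a::topological_space set) \<Rightarrow> bool" where
  "measurable_multifun T S \<longleftrightarrow> (\<forall>U. open U \<longrightarrow> {t \<in> {0..T}. S t \<inter> U \<noteq> {}} \<in> sets (leb T))"

definition caratheodory ::
    "real \<Rightarrow> ('a::topological_space \<Rightarrow> real \<Rightarrow> real) \<Rightarrow> bool" where
  "caratheodory T f \<longleftrightarrow>
     (AE t in leb T. continuous_on UNIV (\<lambda>z. f z t)) \<and>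
     (\<forall>z. (\<lambda>t. f z t) \<in> borel_measurable (leb T))"

text \<open>The infimum is taken in the extended reals, so there is no \<open>\<epsilon>\<close>-optimal point when \<open>f\<close> is
  unbounded below on \<open>S\<close>.\<close>

definition eps_optimal :: "'a set \<Rightarrow> ('a \<Rightarrow> real) \<Rightarrow> real \<Rightarrow> 'a \<Rightarrow> bool" where
  "eps_optimal S f e z \<longleftrightarrow> z \<in> S \<and> ereal (f z) \<le> (INF w\<in>S. ereal (f w)) + ereal e"


section \<open>The optimal control problem\<close>

text \<open>
  The state components are indexed by the type \<open>'n\<close>, so the data with index \<open>0\<close> of the integral cost
  are kept in the separate fields \<open>G0f\<close> and \<open>H0f\<close>. The end point functions are indexed by the natural
  numbers \<open>0, \<dots>, nE\<close>, index \<open>0\<close> being the end point cost. The mixed constraint functions are indexed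
  by \<open>1, \<dots>, nM\<close>.
\<close>

record ('n, 'm) dc_problem =
  hor :: real
  nI :: nat
  nE :: nat
  nM :: nat
  G0f :: "(real ^ 'n) \<times> (real ^ 'm) \<Rightarrow> real \<Rightarrow> real"
  H0f :: "(real ^ 'n) \<times> (real ^ 'm) \<Rightarrow> real \<Rightarrow> real"
  Gf :: "'n \<Rightarrow> (real ^ 'n) \<times> (real ^ 'm) \<Rightarrow> real \<Rightarrow> real"
  Hf :: "'n \<Rightarrow> (real ^ 'n) \<times> (real ^ 'm) \<Rightarrow> real \<Rightarrow> real"
  gf :: "nat \<Rightarrow> (real ^ 'n) \<times> (real ^ 'n) \<Rightarrow> real"
  hf :: "nat \<Rightarrow> (real ^ 'n) \<times> (real ^ 'n) \<Rightarrow> real"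
  pf :: "nat \<Rightarrow> (real ^ 'n) \<times> (real ^ 'm) \<Rightarrow> real \<Rightarrow> real"
  qf :: "nat \<Rightarrow> (real ^ 'n) \<times> (real ^ 'm) \<Rightarrow> real \<Rightarrow> real"

definition integrands ::
    "('n::finite, 'm::finite) dc_problem \<Rightarrow> ((real ^ 'n) \<times> (real ^ 'm) \<Rightarrow> real \<Rightarrow> real) set" where
  "integrands P = {G0f P, H0f P} \<union> range (Gf P) \<union> range (Hf P) \<union> pf P ` {1..nM P} \<union> qf P ` {1..nM P}"

definition dc_data :: "('n::finite, 'm::finite) dc_problem \<Rightarrow> bool" where
  "dc_data P \<longleftrightarrow>
     0 < hor P \<and> nI P \<le> nE P \<and>
     (\<forall>f\<in>integrands P. \<forall>t\<in>{0..hor P}. convex_on UNIV (\<lambda>z. f z t)) \<and>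
     (\<forall>i\<le>nE P. convex_on UNIV (gf P i) \<and> convex_on UNIV (hf P i)) \<and>
     (\<forall>f\<in>integrands P. caratheodory (hor P) f) \<and>
     (\<forall>f\<in>integrands P. \<forall>z\<in>space_X (hor P).
        measurable_multifun (hor P) (\<lambda>t. subdiff (\<lambda>w. f w t) (at_time z t))) \<and>
     (\<forall>R>0. \<exists>\<gamma>>0. AE t in leb (hor P). \<forall>w. norm (fst w) + norm (snd w) \<le> R \<longrightarrow>
        (\<forall>f\<in>integrands P. \<bar>f w t\<bar> \<le> \<gamma> \<and> (\<forall>v\<in>subdiff (\<lambda>w. f w t) w. norm v \<le> \<gamma>)))"

definition cost_J :: "('n::finite, 'm::finite) dc_problem \<Rightarrow> ('n, 'm) traj \<Rightarrow> real" where
  "cost_J P z =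
     (LINT t|leb (hor P). G0f P (at_time z t) t - H0f P (at_time z t) t)
     + (gf P 0 (ends (hor P) z) - hf P 0 (ends (hor P) z))"

definition penalty_term :: "('n::finite, 'm::finite) dc_problem \<Rightarrow> ('n, 'm) traj \<Rightarrow> real" where
  "penalty_term P z =
     (\<Sum>i\<in>UNIV. LINT t|leb (hor P).
        \<bar>xdot (hor P) (fst z) t $ i - (Gf P i (at_time z t) t - Hf P i (at_time z t) t)\<bar>)
     + (\<Sum>i\<in>{1..nI P}. max 0 (gf P i (ends (hor P) z) - hf P i (ends (hor P) z)))
     + (\<Sum>j\<in>{nI P + 1..nE P}. \<bar>gf P j (ends (hor P) z) - hf P j (ends (hor P) z)\<bar>)
     + (\<Sum>s\<in>{1..nM P}. LINT t|leb (hor P). max 0 (pf P s (at_time z t) t - qf P s (at_time z t) t))"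

definition penalty_fun ::
    "('n::finite, 'm::finite) dc_problem \<Rightarrow> real \<Rightarrow> ('n, 'm) traj \<Rightarrow> real" where
  "penalty_fun P c z = cost_J P z + c * penalty_term P z"


section \<open>Convex majorants\<close>

record ('n, 'm) subgrads =
  sV0 :: "real \<Rightarrow> (real ^ 'n) \<times> (real ^ 'm)"
  sV :: "'n \<Rightarrow> real \<Rightarrow> (real ^ 'n) \<times> (real ^ 'm)"
  sW :: "'n \<Rightarrow> real \<Rightarrow> (real ^ 'n) \<times> (real ^ 'm)"
  sv :: "nat \<Rightarrow> (real ^ 'n) \<times> (real ^ 'n)"
  sw :: "nat \<Rightarrow> (real ^ 'n) \<times> (real ^ 'n)"
  sz :: "nat \<Rightarrow> real \<Rightarrow> (real ^ 'n) \<times> (real ^ 'm)"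

definition subgrad_selection ::
    "real \<Rightarrow> ((real ^ 'n) \<times> (real ^ 'm) \<Rightarrow> real \<Rightarrow> real) \<Rightarrow> ('n::finite, 'm::finite) traj
     \<Rightarrow> (real \<Rightarrow> (real ^ 'n) \<times> (real ^ 'm)) \<Rightarrow> bool" where
  "subgrad_selection T f z v \<longleftrightarrow>
     v \<in> borel_measurable (leb T) \<and> (AE t in leb T. v t \<in> subdiff (\<lambda>w. f w t) (at_time z t))"

definition subgrad_collection ::
    "('n::finite, 'm::finite) dc_problem \<Rightarrow> ('n, 'm) traj \<Rightarrow> ('n, 'm) subgrads \<Rightarrow> bool" where
  "subgrad_collection P z V \<longleftrightarrow>
     subgrad_selection (hor P) (H0f P) z (sV0 V) \<and>
     (\<forall>i. subgrad_selection (hor P) (Hf P i) z (sV V i)) \<and>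
     (\<forall>i. subgrad_selection (hor P) (Gf P i) z (sW V i)) \<and>
     (\<forall>i\<in>{0..nE P}. sv V i \<in> subdiff (hf P i) (ends (hor P) z)) \<and>
     (\<forall>j\<in>{nI P + 1..nE P}. sw V j \<in> subdiff (gf P j) (ends (hor P) z)) \<and>
     (\<forall>s\<in>{1..nM P}. subgrad_selection (hor P) (qf P s) z (sz V s))"

text \<open>In the following, \<open>y\<close> is the base point at which the subgradients \<open>V\<close> were chosen, and \<open>z\<close> is
  the argument.\<close>

definition Gamma_maj ::
    "('n::finite, 'm::finite) dc_problem \<Rightarrow> ('n, 'm) traj \<Rightarrow> ('n, 'm) subgrads \<Rightarrow> ('n, 'm) traj \<Rightarrow> real" where
  "Gamma_maj P y V z =
     (\<Sum>i\<in>UNIV. LINT t|leb (hor P).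
        max (xdot (hor P) (fst z) t $ i + Hf P i (at_time z t) t - Gf P i (at_time y t) t
               - sW V i t \<bullet> (at_time z t - at_time y t))
            (- (xdot (hor P) (fst z) t $ i) + Gf P i (at_time z t) t - Hf P i (at_time y t) t
               - sV V i t \<bullet> (at_time z t - at_time y t)))
     + (\<Sum>i\<in>{1..nI P}.
          max 0 (gf P i (ends (hor P) z) - hf P i (ends (hor P) y)
                   - sv V i \<bullet> (ends (hor P) z - ends (hor P) y)))
     + (\<Sum>j\<in>{nI P + 1..nE P}.
          max (gf P j (ends (hor P) z) - hf P j (ends (hor P) y)
                 - sv V j \<bullet> (ends (hor P) z - ends (hor P) y))
              (hf P j (ends (hor P) z) - gf P j (ends (hor P) y)
                 - sw V j \<bullet> (ends (hor P) z - ends (hor P) y)))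
     + (\<Sum>s\<in>{1..nM P}. LINT t|leb (hor P).
          max 0 (pf P s (at_time z t) t - qf P s (at_time y t) t
                   - sz V s t \<bullet> (at_time z t - at_time y t)))"

definition omega_maj ::
    "('n::finite, 'm::finite) dc_problem \<Rightarrow> ('n, 'm) subgrads \<Rightarrow> ('n, 'm) traj \<Rightarrow> real" where
  "omega_maj P V z =
     (LINT t|leb (hor P). G0f P (at_time z t) t - sV0 V t \<bullet> at_time z t)
     + gf P 0 (ends (hor P) z) - sv V 0 \<bullet> ends (hor P) z"

definition Q_maj ::
    "('n::finite, 'm::finite) dc_problem \<Rightarrow> ('n, 'm) traj \<Rightarrow> ('n, 'm) subgrads
     \<Rightarrow> real \<Rightarrow> ('n, 'm) traj \<Rightarrow> real" where
  "Q_maj P y V c z = omega_maj P V z + c * Gamma_maj P y V z"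


section \<open>Penalty updates preceding Step 4 of the method\<close>

text \<open>\<open>raise_until acc c c'\<close>: the loop ``while \<open>acc\<close> fails at the current value, increase that value''
  started at \<open>c\<close> can terminate with the value \<open>c'\<close>. The size of the increases is left open.\<close>

inductive raise_until :: "(real \<Rightarrow> bool) \<Rightarrow> real \<Rightarrow> real \<Rightarrow> bool" for acc where
  stop: "acc c \<Longrightarrow> raise_until acc c c"
| raise: "\<not> acc c \<Longrightarrow> c < c' \<Longrightarrow> raise_until acc c' c'' \<Longrightarrow> raise_until acc c c''"

text \<open>Steps 1 to 3, started with penalty parameter \<open>ck\<close> at the iterate \<open>zk\<close>, can enter Step 4 with the
  value \<open>cp\<close>. Here \<open>\<Gamma>\<close> is the current majorant of the penalty term, \<open>sol c\<close> the computed point for the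
  parameter value \<open>c\<close>, and \<open>zhat\<close> the point computed in Step 2.\<close>

definition enters_step4 ::
    "('a \<Rightarrow> real) \<Rightarrow> 'a \<Rightarrow> (real \<Rightarrow> 'a) \<Rightarrow> 'a \<Rightarrow> real \<Rightarrow> real \<Rightarrow> real \<Rightarrow> real \<Rightarrow> real \<Rightarrow> bool" where
  "enters_step4 \<Gamma> zk sol zhat eps_phi eps_feas eta1 ck cp \<longleftrightarrow>
     (if \<Gamma> (sol ck) \<le> eps_phi then cp = ck
      else if \<Gamma> zhat < \<Gamma> zk
      then raise_until (\<lambda>c. \<Gamma> (sol c) - \<Gamma> zk \<le> eta1 * (\<Gamma> zhat - \<Gamma> zk)) ck cp
      else raise_until (\<lambda>c. \<Gamma> (sol c) \<le> \<Gamma> zk + eps_feas) ck cp)"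

end

theory Submission
  imports Defs
begin

text \<open>
  Write \<open>z\<^sub>c\<close> for the computed point. That \<open>\<omega> + c\<^sub>0 \<Gamma>\<close> has an \<open>\<epsilon>\<close>-optimal point bounds it from
  below, say by \<open>B\<close>. Comparing \<open>z\<^sub>c\<close> with a fixed competitor \<open>z\<close> therefore gives
  \<open>(c - c\<^sub>0) (\<Gamma>(z\<^sub>c) - \<Gamma>(z)) \<le> K\<close> with \<open>K\<close> independent of \<open>c\<close>, so \<open>\<Gamma>(z\<^sub>c)\<close> approaches
  \<open>inf \<Gamma>\<close> as \<open>c \<rightarrow> \<infinity>\<close>, whatever \<open>\<epsilon>\<close> is; parts 1 and 2 follow. Part 3 is immediate when \<open>\<Gamma>\<close> is minimal
  at the current iterate; otherwise \<open>\<Gamma>(z\<^sub>c)\<close> stays a fixed amount below its value there, and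
  competitors \<open>z\<close> with \<open>\<Gamma>(z)\<close> close to \<open>inf \<Gamma>\<close> show that \<open>\<omega>(z\<^sub>c)\<close> grows at most like
  an arbitrarily small multiple of \<open>c\<close>.
\<close>

lemma eps_optimal_le:
  assumes "eps_optimal S f e z" "w \<in> S"
  shows "f z \<le> f w + e"
proof -
  have "ereal (f z) \<le> (INF w\<in>S. ereal (f w)) + ereal e"
    using assms by (simp add: eps_optimal_def)
  also have "\<dots> \<le> ereal (f w) + ereal e"
    by (intro add_right_mono INF_lower assms)
  finally show ?thesis by simp
qed

lemma eps_optimal_mem: "eps_optimal S f e z \<Longrightarrow> z \<in> S"
  by (simp add: eps_optimal_def)

lemma eventually_penalty_less:
  fixes \<omega> \<Gamma> :: "'a \<Rightarrow> real"
  assumes sol: "\<And>c. c0 \<le> c \<Longrightarrow> eps_optimal S (\<lambda>z. \<omega> z + c * \<Gamma> z) e (sol c)"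
    and z: "z \<in> S" "\<Gamma> z < b"
  shows "\<forall>\<^sub>F c in at_top. \<Gamma> (sol c) < b"
proof -
  \<comment> \<open>\<open>B\<close> bounds \<open>\<omega> + c0 * \<Gamma>\<close> from below on
    all of \<open>S\<close>, hence at every \<open>sol c\<close>; this keeps \<open>K\<close>
    independent of \<open>c\<close>.\<close>
  define B where "B = \<omega> (sol c0) + c0 * \<Gamma> (sol c0) - e"
  define K where "K = \<omega> z + e - B + c0 * \<Gamma> z"
  have "\<forall>\<^sub>F c in at_top. max c0 (c0 + K / (b - \<Gamma> z)) < c"
    by (rule eventually_gt_at_top)
  then show ?thesis
  proof eventually_elim
    case (elim c)
    then have c: "c0 < c" "K / (b - \<Gamma> z) < c - c0" by auto
    have "B \<le> \<omega> (sol c) + c0 * \<Gamma> (sol c)"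
      using eps_optimal_le[OF sol[of c0] eps_optimal_mem[OF sol[of c]]] c by (simp add: B_def)
    moreover have "\<omega> (sol c) + c * \<Gamma> (sol c) \<le> \<omega> z + c * \<Gamma> z + e"
      using eps_optimal_le[OF sol[of c] z(1)] c by simp
    ultimately have "(c - c0) * (\<Gamma> (sol c) - \<Gamma> z) \<le> K"
      by (simp add: K_def algebra_simps)
    also have "K < (c - c0) * (b - \<Gamma> z)"
      using c z by (simp add: pos_divide_less_eq)
    finally show ?case using c by simp
  qed
qed

text \<open>Rearranged, the inequality reads \<open>\<omega> (sol c) - \<omega> zk \<le> c * ((1 -
  \<eta>) * (\<Gamma> zk - \<Gamma> (sol c)))\<close>. If \<open>zk\<close> does not minimise
  \<open>\<Gamma>\<close>, the right side grows at least linearly in \<open>c\<close>, with a slope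
  that the left side can be kept below.\<close>

lemma eventually_sufficient_decrease:
  fixes \<omega> \<Gamma> :: "'a \<Rightarrow> real"
  assumes sol: "\<And>c. c0 \<le> c \<Longrightarrow> eps_optimal S (\<lambda>z. \<omega> z + c * \<Gamma> z) e (sol c)"
    and descent: "\<And>c. c0 \<le> c \<Longrightarrow> \<omega> (sol c) + c * \<Gamma> (sol c) \<le> \<omega> zk + c * \<Gamma> zk"
    and bdd: "bdd_below (\<Gamma> ` S)"
    and \<eta>: "0 < \<eta>" "\<eta> < 1"
  shows "\<forall>\<^sub>F c in at_top. (\<omega> (sol c) + c * \<Gamma> (sol c)) - (\<omega> zk + c * \<Gamma> zk)
                             \<le> c * \<eta> * (\<Gamma> (sol c) - \<Gamma> zk)"
proof (cases "\<exists>z\<in>S. \<Gamma> z < \<Gamma> zk")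
  \<comment> \<open>Here \<open>\<Gamma> (sol c)\<close> is at least \<open>\<Gamma> zk\<close>, so
    the right side is nonnegative, while descent makes the left side nonpositive.\<close>
  case False
  have "\<forall>\<^sub>F c in at_top. max 0 c0 \<le> c" by (rule eventually_ge_at_top)
  then show ?thesis
  proof eventually_elim
    case (elim c)
    then have "0 \<le> c * \<eta> * (\<Gamma> (sol c) - \<Gamma> zk)"
      using False \<eta> eps_optimal_mem[OF sol[of c]] by (intro mult_nonneg_nonneg) force+
    then show ?case using descent[of c] elim by simp
  qed
next
  case True
  then obtain y where y: "y \<in> S" "\<Gamma> y < \<Gamma> zk" by blast
  define m where "m = Inf (\<Gamma> ` S)"
  have m_le: "m \<le> \<Gamma> z" if "z \<in> S" for z
    unfolding m_def by (rule cInf_lower[OF imageI[OF that] bdd])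
  \<comment> \<open>Halving leaves \<open>\<Gamma> y\<close> strictly below
    \<open>\<Gamma> zk - a\<close>; \<open>d\<close> is chosen so that two errors of size
    \<open>c * d\<close> add up to \<open>c * ((1 - \<eta>) * a)\<close>.\<close>
  define a where "a = (\<Gamma> zk - \<Gamma> y) / 2"
  define d where "d = (1 - \<eta>) * a / 2"
  have pos: "0 < a" "0 < d" using y \<eta> by (auto simp: a_def d_def)
  then obtain z where z: "z \<in> S" "\<Gamma> z < m + d"
    using cInf_less_iff[of "\<Gamma> ` S" "m + d"] bdd y(1) by (auto simp: m_def)
  define L where "L = \<omega> z + e - \<omega> zk"
  have "\<forall>\<^sub>F c in at_top. \<Gamma> (sol c) < \<Gamma> zk - a"
    by (rule eventually_penalty_less[OF sol y(1)]) (use y in \<open>auto simp: a_def field_simps\<close>)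
  moreover have "\<forall>\<^sub>F c in at_top. max (max 0 c0) (L / d) \<le> c"
    by (rule eventually_ge_at_top)
  ultimately show ?thesis
  proof eventually_elim
    case (elim c)
    then have c: "0 \<le> c" "c0 \<le> c" and L: "L \<le> c * d"
      using pos by (auto simp: pos_divide_le_eq)
    have "\<omega> (sol c) - \<omega> zk \<le> L + c * (\<Gamma> z - \<Gamma> (sol c))"
      using eps_optimal_le[OF sol[OF c(2)] z(1)] by (simp add: L_def algebra_simps)
    \<comment> \<open>One \<open>c * d\<close> absorbs the constant \<open>L\<close>, as
      \<open>c\<close> is at least \<open>L / d\<close>; the other covers
      \<open>\<Gamma> z - \<Gamma> (sol c)\<close>, which is below \<open>d\<close> because
      \<open>\<Gamma> (sol c)\<close> is at least the infimum \<open>m\<close>.\<close>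
    also have "\<dots> \<le> c * d + c * d"
      using z(2) m_le[OF eps_optimal_mem[OF sol[OF c(2)]]] c(1) L
      by (intro add_mono mult_left_mono) auto
    also have "\<dots> = c * ((1 - \<eta>) * a)" by (simp add: d_def)
    also have "\<dots> \<le> c * ((1 - \<eta>) * (\<Gamma> zk - \<Gamma> (sol c)))"
      using elim(1) c(1) \<eta> by (intro mult_left_mono) auto
    finally show ?case by (simp add: algebra_simps)
  qed
qed

lemma eventually_at_top_bound:
  fixes b :: real
  assumes "\<forall>\<^sub>F c in at_top. Q c"
  shows "\<exists>cs\<ge>b. \<forall>c\<ge>cs. Q c"
proof -
  obtain N where "\<forall>c\<ge>N. Q c" using assms by (auto simp: eventually_at_top_linorder)
  then show ?thesis by (intro exI[of _ "max N b"]) auto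
qed

theorem theorem1:
  fixes P :: "('n::finite, 'm::finite) dc_problem"
    and X0 :: "('n, 'm) traj set"
    and zk zhat :: "('n, 'm) traj"
    and sol :: "real \<Rightarrow> ('n, 'm) traj"
    and V :: "('n, 'm) subgrads"
    and c0 ck epsk eps_phi eps_feas eta1 :: real
  assumes data: "dc_data P"
    and X0: "X0 \<subseteq> space_X (hor P)" "convex_trajs X0" "closed_in_X (hor P) X0"
    and params: "0 < c0" "0 < eps_phi" "0 < eps_feas" "0 < eta1" "eta1 < 1"
    and bounded: "bdd_below (penalty_fun P c0 ` X0)"
    and iterate: "zk \<in> X0" "subgrad_collection P zk V" "c0 \<le> ck"
    and epsk: "0 \<le> epsk"
    and sol: "\<And>c. c0 \<le> c \<Longrightarrow> eps_optimal X0 (Q_maj P zk V c) epsk (sol c)"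
             "\<And>c. c0 \<le> c \<Longrightarrow> Q_maj P zk V c (sol c) \<le> Q_maj P zk V c zk"
    and zhat: "eps_optimal X0 (Gamma_maj P zk V) epsk zhat"
  shows
    "(Gamma_maj P zk V zhat \<ge> Gamma_maj P zk V zk \<longrightarrow>
        (\<forall>e>0. \<exists>cs>0. \<forall>c\<ge>cs. Gamma_maj P zk V (sol c) \<le> Gamma_maj P zk V zk + e))
     \<and>
     (Gamma_maj P zk V zhat < Gamma_maj P zk V zk \<longrightarrow>
        (\<forall>\<eta>. 0 < \<eta> \<and> \<eta> < 1 \<longrightarrow>
           (\<exists>cs>0. \<forall>c\<ge>cs. Gamma_maj P zk V (sol c) - Gamma_maj P zk V zk
                             \<le> \<eta> * (Gamma_maj P zk V zhat - Gamma_maj P zk V zk))))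
     \<and>
     (\<forall>cp. enters_step4 (Gamma_maj P zk V) zk sol zhat eps_phi eps_feas eta1 ck cp \<longrightarrow>
        (\<forall>\<eta>. 0 < \<eta> \<and> \<eta> < 1 \<longrightarrow>
           (\<exists>cs\<ge>cp. \<forall>c\<ge>cs. Q_maj P zk V c (sol c) - Q_maj P zk V c zk
                             \<le> c * \<eta> * (Gamma_maj P zk V (sol c) - Gamma_maj P zk V zk))))"
proof -
  let ?\<Gamma> = "Gamma_maj P zk V" and ?\<omega> = "omega_maj P V"
  have opt: "eps_optimal X0 (\<lambda>z. ?\<omega> z + c * ?\<Gamma> z) epsk (sol c)" if "c0 \<le> c" for c
    using sol(1)[OF that] by (simp add: Q_maj_def[abs_def])
  have le: "\<exists>cs>0. \<forall>c\<ge>cs. ?\<Gamma> (sol c) \<le> b" if "z \<in> X0" "?\<Gamma> z < b" for z b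
  proof -
    have "\<forall>\<^sub>F c in at_top. ?\<Gamma> (sol c) < b"
      by (rule eventually_penalty_less[of c0 X0 ?\<omega> ?\<Gamma> epsk sol z]) (fact opt that)+
    then have "\<forall>\<^sub>F c in at_top. ?\<Gamma> (sol c) \<le> b"
      by (rule eventually_mono) (rule less_imp_le)
    then obtain cs :: real where "1 \<le> cs" "\<forall>c\<ge>cs. ?\<Gamma> (sol c) \<le> b"
      using eventually_at_top_bound[of "\<lambda>c. ?\<Gamma> (sol c) \<le> b" 1] by blast
    then show ?thesis by (intro exI[of _ cs]) simp
  qed
  have bdd: "bdd_below (?\<Gamma> ` X0)"
    using eps_optimal_le[OF zhat] by (intro bdd_belowI2[of _ "?\<Gamma> zhat - epsk"]) (simp add: diff_le_eq)
  have decrease: "\<forall>\<^sub>F c in at_top. Q_maj P zk V c (sol c) - Q_maj P zk V c zk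
                                       \<le> c * \<eta> * (?\<Gamma> (sol c) - ?\<Gamma> zk)"
    if "0 < \<eta>" "\<eta> < 1" for \<eta>
    unfolding Q_maj_def
    by (rule eventually_sufficient_decrease[of c0 X0 ?\<omega> ?\<Gamma> epsk sol zk])
      (fact opt sol(2)[unfolded Q_maj_def] bdd that)+
  show ?thesis
  proof (intro conjI allI impI)
    fix e :: real
    assume "0 < e"
    \<comment> \<open>The competitor is the iterate \<open>zk\<close> itself, with \<open>e\<close>
      as the strict gap.\<close>
    then show "\<exists>cs>0. \<forall>c\<ge>cs. ?\<Gamma> (sol c) \<le> ?\<Gamma> zk + e"
      by (intro le[OF iterate(1)]) simp
  next
    fix \<eta> :: real
    assume "?\<Gamma> zhat < ?\<Gamma> zk" "0 < \<eta> \<and> \<eta> < 1"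
    \<comment> \<open>The required decrease is only a fraction \<open>\<eta> < 1\<close> of the one
      \<open>zhat\<close> achieves, so \<open>zhat\<close> beats the target strictly and can serve
      as the competitor.\<close>
    then have "\<eta> * (?\<Gamma> zk - ?\<Gamma> zhat) < 1 * (?\<Gamma> zk - ?\<Gamma> zhat)"
      by (intro mult_strict_right_mono) auto
    then have "?\<Gamma> zhat < ?\<Gamma> zk + \<eta> * (?\<Gamma> zhat - ?\<Gamma> zk)"
      by (simp add: algebra_simps)
    from le[OF eps_optimal_mem[OF zhat] this]
    show "\<exists>cs>0. \<forall>c\<ge>cs. ?\<Gamma> (sol c) - ?\<Gamma> zk \<le> \<eta> * (?\<Gamma> zhat - ?\<Gamma> zk)"
      by (simp add: diff_le_eq add.commute)
  next
    fix cp \<eta> :: real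
    assume "0 < \<eta> \<and> \<eta> < 1"
    \<comment> \<open>The estimate holds for all large \<open>c\<close>, so its threshold can be
      raised to at least \<open>cp\<close>.\<close>
    then show "\<exists>cs\<ge>cp. \<forall>c\<ge>cs. Q_maj P zk V c (sol c) - Q_maj P zk V c zk
                                   \<le> c * \<eta> * (?\<Gamma> (sol c) - ?\<Gamma> zk)"
      by (intro eventually_at_top_bound decrease) auto
  qed
qed

end
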